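(* Let $k\ge 1$ be an integer. Define functions near $x=0$ by $$f_1(x)=\frac12\log\frac{1+2\sin\frac{x}{2}}{1-2\sin\frac{x}{2}},\qquad f_j(x)=\int_0^x\frac{f_{j-1}(t)}{2\tan\frac{t}{2}}\,dt\quad(j=2,\dots,k).$$ Then $$\frac{f_k(x)}{2\sin\frac{x}{2}}=\sum_{n=0}^\infty\mathfrak B_n^{(k)}\frac{x^n}{n!}.$$ (That is, the generating function of $\mathfrak B_n^{(k)}$ equals $\frac{1}{2\sin(x/2)}$ times the $(k-1)$-fold iterated integral, each integration being against $\frac{1}{2\tan(x/2)}\,dx$ from $0$ to $x$, applied to $\frac12\log\frac{1+2\sin(x/2)}{1-2\sin(x/2)}$.)
   Context: For an integer $k$, the polylogarithm with level $2$ is ${\rm Li}_{2,k}(z)=\sum_{n=0}^\infty\frac{z^{2n+1}}{(2n+1)^k}$. The poly-Bernoulli numbers with level $2$, $\mathfrak B_n^{(k)}$, are defined by $$\frac{{\rm Li}_{2,k}\bigl(2\sin(x/2)\bigr)}{2\sin(x/2)}=\sum_{n=0}^\infty\mathfrak B_n^{(k)}\frac{x^n}{n!}.$$ *)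

theory Defs
  imports "HOL-Complex_Analysis.Complex_Analysis"
begin

definition fps_polylog2 :: "int \<Rightarrow> 'a::field_char_0 fps" where
  "fps_polylog2 k = Abs_fps (\<lambda>m. if odd m then 1 / of_nat m powi k else 0)"

(* the expansion of 2 sin (x/2) at x = 0 *)
definition fps_two_sin_half :: "'a::field_char_0 fps" where
  "fps_two_sin_half = fps_const 2 * fps_sin (1/2)"

(* The generating function is read as a formal power series; both series in the
   quotient have subdegree 1, so the division is exact, see poly_bernoulli2_gf. *)
definition poly_bernoulli2 :: "int \<Rightarrow> nat \<Rightarrow> 'a::field_char_0" where
  "poly_bernoulli2 k n =
     fact n * fps_nth ((fps_polylog2 k oo fps_two_sin_half) / fps_two_sin_half) n"

lemma poly_bernoulli2_gf:
  "Abs_fps (\<lambda>n. poly_bernoulli2 k n / fact n) * fps_two_sin_half =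
     (fps_polylog2 k oo fps_two_sin_half :: 'a::field_char_0 fps)"
proof -
  let ?S = "fps_two_sin_half :: 'a fps" and ?L = "fps_polylog2 k :: 'a fps"
  have S: "fps_nth ?S 0 = 0" "fps_nth ?S 1 \<noteq> 0"
    by (simp_all add: fps_two_sin_half_def fps_sin_def)
  have sub: "subdegree ?S = 1"
    using S by (intro subdegreeI) auto
  have "fps_nth (?L oo ?S) 0 = 0"
    by (simp add: fps_polylog2_def)
  hence "?L oo ?S = 0 \<or> subdegree (?L oo ?S) \<ge> 1"
    by (metis One_nat_def Suc_leI gr0I subdegree_eq_0_iff nth_subdegree_nonzero)
  hence "?S dvd ?L oo ?S"
    using S sub by (metis dvd_0_right fps_dvd_iff subdegree_0 not_one_le_zero)
  moreover have "Abs_fps (\<lambda>n. poly_bernoulli2 k n / fact n) = (?L oo ?S) / ?S"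
    by (simp add: fps_eq_iff poly_bernoulli2_def)
  ultimately show ?thesis by simp
qed

end

theory Submission
  imports Defs
begin

text \<open>
  Write \<open>L\<^sub>k\<close> for the polylogarithm series of level 2 and \<open>S = 2 sin (x/2)\<close>. Since
  \<open>z L\<^sub>k\<^sub>+\<^sub>1'(z) = L\<^sub>k(z)\<close>, the chain rule gives
  \<open>S (L\<^sub>k\<^sub>+\<^sub>1 \<circ> S)' = S' (L\<^sub>k \<circ> S)\<close>, and \<open>S'/S = 1 / (2 tan (x/2))\<close>. Hence \<open>f\<^sub>k\<close> has the
  expansion \<open>L\<^sub>k \<circ> S\<close> by induction on \<open>k\<close>, starting from \<open>L\<^sub>1 = artanh\<close>.
\<close>

section \<open>The polylogarithm series of level 2, and artanh as its first case\<close>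

lemma fps_polylog2_nth_0 [simp]: "fps_nth (fps_polylog2 k) 0 = 0"
  by (simp add: fps_polylog2_def)

lemma fps_X_mult_deriv_polylog2:
  "fps_X * fps_deriv (fps_polylog2 (k + 1)) = (fps_polylog2 k :: 'a :: field_char_0 fps)"
proof (rule fps_ext)
  fix n
  show "fps_nth (fps_X * fps_deriv (fps_polylog2 (k + 1))) n = fps_nth (fps_polylog2 k :: 'a fps) n"
    \<comment> \<open>For positive \<open>n\<close>, differentiation brings down a factor
      \<open>n\<close>, which cancels one power of the denominator.\<close>
    by (cases n) (auto simp: fps_polylog2_def power_int_add simp del: of_nat_Suc)
qed

text \<open>The derivative is the geometric series in \<open>fps_X ^ 2\<close>. Together with the
  value at 0 this equation pins down the series of artanh.\<close>

lemma fps_deriv_polylog2_1: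
  "(1 - fps_X ^ 2) * fps_deriv (fps_polylog2 1) = (1 :: 'a :: field_char_0 fps)"
proof -
  have "fps_nth (fps_deriv (fps_polylog2 1)) n = (if even n then 1 else 0 :: 'a)" for n
    by (auto simp: fps_polylog2_def simp del: of_nat_Suc)
  thus ?thesis
    by (auto simp: fps_eq_iff left_diff_distrib fps_X_power_mult_nth less_2_cases_iff
             simp del: fps_deriv_nth)
qed

text \<open>For a nonnegative exponent all coefficients have norm at most 1, so comparison with a
  geometric series gives convergence at 1/2. Any positive radius suffices to treat the series as an
  analytic germ.\<close>

lemma fps_conv_radius_polylog2_pos:
  "fps_conv_radius (fps_polylog2 (int k) :: complex fps) > 0"
proof -
  have "summable (\<lambda>n. fps_nth (fps_polylog2 (int k)) n * (1/2 :: complex) ^ n)"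
  proof (rule summable_comparison_test')
    show "summable (\<lambda>n. (1/2 :: real) ^ n)"
      by (rule summable_geometric) simp
  next
    fix n :: nat
    have "norm (1 / of_nat n ^ k :: complex) \<le> 1" if "odd n"
      using that by (auto simp: norm_divide norm_power odd_pos Suc_le_eq)
    hence "norm (fps_nth (fps_polylog2 (int k)) n :: complex) \<le> 1"
      by (simp add: fps_polylog2_def)
    thus "norm (fps_nth (fps_polylog2 (int k)) n * (1/2 :: complex) ^ n) \<le> (1/2) ^ n"
      by (simp add: norm_mult norm_power norm_divide mult_left_le_one_le divide_right_mono)
  qed
  hence "ereal (norm (1/2 :: complex)) \<le> fps_conv_radius (fps_polylog2 (int k) :: complex fps)"
    unfolding fps_conv_radius_def by (rule conv_radius_geI)
  moreover have "0 < ereal (norm (1/2 :: complex))" by simp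
  ultimately show ?thesis by (rule less_le_trans[rotated])
qed

text \<open>The function is holomorphic on the unit disc, so it has some expansion \<open>F\<close>.
  Both \<open>F\<close> and \<open>fps_polylog2 1\<close> vanish at 0 and satisfy
  \<open>(1 - fps_X ^ 2) * fps_deriv F = 1\<close>, hence they coincide.\<close>

lemma has_fps_expansion_artanh:
  "(\<lambda>z::complex. 1/2 * ln ((1 + z) / (1 - z))) has_fps_expansion fps_polylog2 1"
proof -
  define g where "g = (\<lambda>z::complex. 1/2 * ln ((1 + z) / (1 - z)))"
  define F where "F = fps_expansion g 0"
  \<comment> \<open>The Moebius map stays off the branch cut of \<open>ln\<close>: a value
    \<open>r\<close> \<le> 0 would give \<open>norm z * \<bar>1 + r\<bar> = 1 - r\<close>, which
    forces \<open>r = 0\<close> and then \<open>norm z = 1\<close>.\<close>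
  have dom: "(1 + z) / (1 - z) \<notin> \<real>\<^sub>\<le>\<^sub>0" if "norm z < 1" for z :: complex
  proof
    assume "(1 + z) / (1 - z) \<in> \<real>\<^sub>\<le>\<^sub>0"
    then obtain r where r: "(1 + z) / (1 - z) = of_real r" "r \<le> 0"
      by (auto elim!: nonpos_Reals_cases)
    have "1 - z \<noteq> 0" using that by auto
    hence "1 + z = of_real r * (1 - z)" using r by (simp add: field_simps)
    hence "z * of_real (1 + r) = of_real (r - 1)" by (simp add: algebra_simps)
    hence "norm z * \<bar>1 + r\<bar> = \<bar>r - 1\<bar>" by (metis norm_mult norm_of_real)
    moreover have "norm z * \<bar>1 + r\<bar> \<le> \<bar>1 + r\<bar>" using that by (simp add: mult_left_le_one_le)
    ultimately have "r = 0" using r by linarith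
    thus False using \<open>norm z * \<bar>1 + r\<bar> = \<bar>r - 1\<bar>\<close> that by simp
  qed
  have deriv: "(g has_field_derivative 1 / (1 - z ^ 2)) (at z)" if "norm z < 1" for z
  proof -
    have nz: "1 - z \<noteq> 0" "1 + z \<noteq> 0" using that by (auto simp: add_eq_0_iff)
    moreover have "1 - z ^ 2 \<noteq> 0"
      using nz by (metis mult_eq_0_iff power_one square_diff_square_factored power2_eq_square)
    ultimately show ?thesis
      unfolding g_def using dom[OF that]
      by (auto intro!: derivative_eq_intros simp: divide_simps)
         (auto simp: algebra_simps power2_eq_square)
  qed
  have holo: "g holomorphic_on ball 0 1"
    by (subst holomorphic_on_open) (auto intro!: exI deriv)
  hence F: "g has_fps_expansion F"
    unfolding F_def by (intro has_fps_expansion_fps_expansion[of "ball 0 1"]) auto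
  have "eventually (\<lambda>z. z \<in> ball 0 1) (nhds (0::complex))"
    by (intro eventually_nhds_in_open) auto
  hence "eventually (\<lambda>z. (1 - z ^ 2) * deriv g z = 1) (nhds 0)"
  proof eventually_elim
    case (elim z)
    hence "norm z < 1" by simp
    moreover from this have "norm (z ^ 2) < 1"
      by (simp add: norm_power power_less_one_iff)
    hence "1 - z ^ 2 \<noteq> 0" by auto
    ultimately show ?case using DERIV_imp_deriv[OF deriv] by auto
  qed
  moreover have "(\<lambda>z. (1 - z ^ 2) * deriv g z) has_fps_expansion (1 - fps_X ^ 2) * fps_deriv F"
    by (intro fps_expansion_intros F)
  ultimately have "(\<lambda>_. 1) has_fps_expansion (1 - fps_X ^ 2) * fps_deriv F"
    by (subst (asm) has_fps_expansion_cong) auto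
  hence "(1 - fps_X ^ 2) * fps_deriv F = 1"
    using fps_expansion_unique_complex has_fps_expansion_1 by blast
  hence "(1 - fps_X ^ 2) * fps_deriv F = (1 - fps_X ^ 2) * fps_deriv (fps_polylog2 1)"
    by (simp add: fps_deriv_polylog2_1)
  \<comment> \<open>A factor of 1 cannot be 0, so it may be cancelled in the integral domain of
    power series.\<close>
  moreover have "(1 - fps_X ^ 2 :: complex fps) \<noteq> 0"
    using fps_deriv_polylog2_1[where 'a = complex] by (metis mult_zero_left zero_neq_one)
  ultimately have "fps_deriv F = fps_deriv (fps_polylog2 1)" by simp
  moreover have "fps_nth F 0 = 0"
    using has_fps_expansion_imp_0_eq_fps_nth_0[OF F] by (simp add: g_def)
  ultimately have "F = fps_polylog2 1"
    by (simp add: fps_deriv_eq_iff)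
  thus ?thesis using F by (simp add: g_def)
qed

section \<open>The series of 2 sin (x/2) and composition with it\<close>

lemma fps_two_sin_half_nth_0 [simp]: "fps_nth fps_two_sin_half 0 = 0"
  by (simp add: fps_two_sin_half_def fps_sin_def)

lemma fps_two_sin_half_nth_1 [simp]: "fps_nth fps_two_sin_half (Suc 0) = 1"
  by (simp add: fps_two_sin_half_def fps_sin_def)

lemma subdegree_fps_two_sin_half [simp]:
  "subdegree (fps_two_sin_half :: 'a :: field_char_0 fps) = 1"
  by (intro subdegreeI) auto

lemma fps_two_sin_half_nonzero [simp]: "fps_two_sin_half \<noteq> (0 :: 'a :: field_char_0 fps)"
  using subdegree_fps_two_sin_half[where 'a = 'a] by (metis subdegree_0 zero_neq_one)

lemma fps_deriv_two_sin_half: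
  "fps_deriv fps_two_sin_half = (fps_cos (1/2) :: 'a :: field_char_0 fps)"
proof -
  have "fps_const 2 * (fps_const (1/2) * fps_cos (1/2)) = (fps_cos (1/2) :: 'a fps)"
    by (simp flip: mult.assoc)
  thus ?thesis by (simp add: fps_two_sin_half_def fps_sin_deriv)
qed

lemma has_fps_expansion_two_sin_half:
  "(\<lambda>x::complex. 2 * sin (x/2)) has_fps_expansion fps_two_sin_half"
  using has_fps_expansion_cmult_left[OF has_fps_expansion_sin[of "1/2"], of 2]
  by (simp add: fps_two_sin_half_def)

text \<open>Chain rule applied to \<open>fps_X_mult_deriv_polylog2\<close>. The factor
  \<open>fps_two_sin_half\<close> is multiplied out because its constant term is 0, so it is not a
  unit.\<close>

lemma fps_deriv_polylog2_compose:
  "fps_two_sin_half * fps_deriv (fps_polylog2 (k + 1) oo fps_two_sin_half) =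
     (fps_polylog2 k oo fps_two_sin_half) * (fps_cos (1/2) :: 'a :: field_char_0 fps)"
proof -
  \<comment> \<open>The outer factor is \<open>fps_X\<close> composed with
    \<open>fps_two_sin_half\<close>, so it moves inside the composition.\<close>
  have "fps_two_sin_half * (fps_deriv (fps_polylog2 (k + 1)) oo fps_two_sin_half) =
          ((fps_X * fps_deriv (fps_polylog2 (k + 1))) oo fps_two_sin_half :: 'a fps)"
    by (simp add: fps_compose_mult_distrib)
  also have "\<dots> = fps_polylog2 k oo fps_two_sin_half"
    by (simp only: fps_X_mult_deriv_polylog2)
  finally show ?thesis
    by (simp add: fps_compose_deriv fps_deriv_two_sin_half mult.assoc [symmetric])
qed

section \<open>From formal series to functions near 0: summation and integration\<close>

lemma has_fps_expansion_sums:
  fixes f :: "complex \<Rightarrow> complex"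
  assumes "f has_fps_expansion F"
  shows "eventually (\<lambda>z. (\<lambda>n. fps_nth F n * z ^ n) sums f z) (nhds 0)"
proof -
  have "eventually (\<lambda>z. z \<in> eball 0 (fps_conv_radius F)) (nhds 0)"
    using assms by (intro eventually_nhds_in_open) (auto simp: has_fps_expansion_def zero_ereal_def)
  moreover have "eventually (\<lambda>z. eval_fps F z = f z) (nhds 0)"
    using assms by (simp add: has_fps_expansion_def)
  ultimately show ?thesis
    by eventually_elim (use sums_eval_fps in \<open>fastforce simp: eball_def\<close>)
qed

text \<open>The value of \<open>h\<close> at 0 is left free: the integrand of the theorem is \<open>0/0\<close> there.\<close>

lemma has_fps_expansion_contour_integral:
  assumes F: "fps_conv_radius F > 0" "fps_nth F 0 = 0"
    and h: "\<forall>\<^sub>F t in at 0. h t = eval_fps (fps_deriv F) t"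
  shows "(\<lambda>x. contour_integral (linepath 0 x) h) has_fps_expansion F"
proof -
  from h obtain d where d: "d > 0" "\<And>t. t \<noteq> 0 \<Longrightarrow> norm t < d \<Longrightarrow> h t = eval_fps (fps_deriv F) t"
    unfolding eventually_at by (auto simp: dist_norm)
  have "open (ball 0 d \<inter> eball (0::complex) (fps_conv_radius F))"
       "0 \<in> ball 0 d \<inter> eball (0::complex) (fps_conv_radius F)"
    using F d by (auto simp: zero_ereal_def)
  then obtain r where r: "r > 0" "ball 0 r \<subseteq> ball 0 d \<inter> eball (0::complex) (fps_conv_radius F)"
    by (meson open_contains_ball)
  have "eventually (\<lambda>x. x \<in> ball (0::complex) r) (nhds 0)"
    using r by (intro eventually_nhds_in_open) auto
  hence "eventually (\<lambda>x. eval_fps F x = contour_integral (linepath 0 x) h) (nhds 0)"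
  proof eventually_elim
    case (elim x)
    have seg: "closed_segment 0 x \<subseteq> ball 0 r"
      using elim r by (intro closed_segment_subset) auto
    \<comment> \<open>Inside the disc of convergence \<open>eval_fps F\<close> is a primitive; its
      value at the starting point 0 is 0.\<close>
    have "(eval_fps (fps_deriv F) has_contour_integral
            eval_fps F (pathfinish (linepath 0 x)) - eval_fps F (pathstart (linepath 0 x))) (linepath 0 x)"
      using seg r by (intro contour_integral_primitive[of "ball 0 r"] has_field_derivative_eval_fps)
                     (auto simp: eball_def simp del: linepath_0)
    hence int: "(eval_fps (fps_deriv F) has_contour_integral eval_fps F x) (linepath 0 x)"
      using F by (simp add: eval_fps_at_0)
    \<comment> \<open>For \<open>x\<close> nonzero the segment meets 0 only at parameter 0, and
      changing the integrand at one parameter leaves the integral unchanged. For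
      \<open>x = 0\<close> the path is constant and both sides are 0.\<close>
    have "(h has_contour_integral eval_fps F x) (linepath 0 x)"
    proof (cases "x = 0")
      case True
      thus ?thesis using F by (simp add: eval_fps_at_0)
    next
      case False
      show ?thesis unfolding has_contour_integral_linepath
      proof (rule has_integral_spike_finite)
        show "((\<lambda>t. eval_fps (fps_deriv F) (linepath 0 x t) * (x - 0)) has_integral eval_fps F x) {0..1}"
          using int by (simp add: has_contour_integral_linepath)
        fix t :: real assume t: "t \<in> {0..1} - {0}"
        have "linepath 0 x t \<in> closed_segment 0 x"
          using t by (intro linepath_in_path) auto
        hence "norm (linepath 0 x t) < d" using seg r by auto
        moreover have "linepath 0 x t \<noteq> 0" using t False by (simp add: linepath_def)
        ultimately show "h (linepath 0 x t) * (x - 0) = eval_fps (fps_deriv F) (linepath 0 x t) * (x - 0)"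
          using d(2) by simp
      qed simp
    qed
    thus ?case by (simp add: contour_integral_unique)
  qed
  thus ?thesis using F by (simp add: has_fps_expansion_def)
qed

section \<open>The iterated integrals and the generating function\<close>

lemma has_fps_expansion_iterated_integral:
  fixes f :: "nat \<Rightarrow> complex \<Rightarrow> complex"
  assumes "k \<ge> 1"
    and "\<forall>\<^sub>F x in nhds 0. f 1 x = 1/2 * ln ((1 + 2 * sin (x/2)) / (1 - 2 * sin (x/2)))"
    and "\<And>j. 2 \<le> j \<Longrightarrow> j \<le> k \<Longrightarrow>
           \<forall>\<^sub>F x in nhds 0. f j x = contour_integral (linepath 0 x) (\<lambda>t. f (j-1) t / (2 * tan (t/2)))"
  shows "f k has_fps_expansion (fps_polylog2 (int k) oo fps_two_sin_half)"
  using assms(1,3)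
proof (induction k rule: nat_induct_at_least)
  case base
  have "((\<lambda>z. 1/2 * ln ((1 + z) / (1 - z))) \<circ> (\<lambda>x. 2 * sin (x/2)))
          has_fps_expansion (fps_polylog2 1 oo (fps_two_sin_half :: complex fps))"
    by (intro has_fps_expansion_compose has_fps_expansion_artanh has_fps_expansion_two_sin_half) simp
  thus ?case
    using has_fps_expansion_cong[OF assms(2) refl] by (simp add: o_def)
next
  case (Suc k)
  define P :: "nat \<Rightarrow> complex fps" where "P = (\<lambda>k. fps_polylog2 (int k) oo fps_two_sin_half)"
  have IH: "f k has_fps_expansion P k"
    using Suc by (simp add: P_def)
  have "(eval_fps (fps_polylog2 (int (Suc k))) \<circ> (\<lambda>x. 2 * sin (x/2))) has_fps_expansion P (Suc k)"
    unfolding P_def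
    by (intro has_fps_expansion_compose eval_fps_has_fps_expansion fps_conv_radius_polylog2_pos
              has_fps_expansion_two_sin_half) simp
  hence radius: "fps_conv_radius (P (Suc k)) > 0"
    by (simp add: has_fps_expansion_def)
  have P': "eval_fps (fps_deriv (P (Suc k))) has_fps_expansion fps_deriv (P (Suc k))"
    using radius fps_conv_radius_deriv[of "P (Suc k)"]
    by (intro eval_fps_has_fps_expansion) (rule less_le_trans)
  have 1: "(\<lambda>x. 2 * sin (x/2) * eval_fps (fps_deriv (P (Suc k))) x)
             has_fps_expansion P k * fps_cos (1/2)"
    using has_fps_expansion_mult[OF has_fps_expansion_two_sin_half P']
          fps_deriv_polylog2_compose[of "int k", where 'a = complex]
    by (simp add: P_def add.commute)
  have 2: "(\<lambda>x. f k x * cos (x/2)) has_fps_expansion P k * fps_cos (1/2)"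
    using has_fps_expansion_mult[OF IH has_fps_expansion_cos[of "1/2"]] by simp
  have "\<forall>\<^sub>F x in nhds 0. 2 * sin (x/2) * eval_fps (fps_deriv (P (Suc k))) x = f k x * cos (x/2)"
    using 1 2 unfolding has_fps_expansion_def by (auto elim: eventually_elim2)
  hence ode: "\<forall>\<^sub>F x in at 0. 2 * sin (x/2) * eval_fps (fps_deriv (P (Suc k))) x = f k x * cos (x/2)"
    by (simp add: eventually_nhds_conv_at)
  have "\<forall>\<^sub>F x in at 0. 2 * sin (x/2) \<noteq> (0::complex)"
    using has_laurent_expansion_fps[OF has_fps_expansion_two_sin_half]
    by (rule has_laurent_expansion_nonzero_imp_eventually_nonzero) simp
  with ode have "\<forall>\<^sub>F t in at 0. f k t / (2 * tan (t/2)) = eval_fps (fps_deriv (P (Suc k))) t"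
    by eventually_elim (simp add: tan_def field_simps)
  hence "(\<lambda>x. contour_integral (linepath 0 x) (\<lambda>t. f k t / (2 * tan (t/2)))) has_fps_expansion P (Suc k)"
    by (intro has_fps_expansion_contour_integral radius) (simp_all add: P_def)
  moreover have "\<forall>\<^sub>F x in nhds 0. f (Suc k) x =
                    contour_integral (linepath 0 x) (\<lambda>t. f k t / (2 * tan (t/2)))"
    using Suc.prems[of "Suc k"] Suc.hyps by (simp del: linepath_0)
  ultimately show ?case
    unfolding P_def by (subst has_fps_expansion_cong) auto
qed

theorem theorem3:
  fixes k :: nat and f :: "nat \<Rightarrow> complex \<Rightarrow> complex"
  assumes "k \<ge> 1"
    and "\<forall>\<^sub>F x in nhds 0. f 1 x = 1/2 * ln ((1 + 2 * sin (x/2)) / (1 - 2 * sin (x/2)))"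
    and "\<And>j. 2 \<le> j \<Longrightarrow> j \<le> k \<Longrightarrow>
           \<forall>\<^sub>F x in nhds 0. f j x = contour_integral (linepath 0 x) (\<lambda>t. f (j-1) t / (2 * tan (t/2)))"
  shows "\<forall>\<^sub>F x in at 0.
           (\<lambda>n. poly_bernoulli2 (int k) n * x ^ n / fact n) sums (f k x / (2 * sin (x/2)))"
proof -
  define P where "P = fps_polylog2 (int k) oo (fps_two_sin_half :: complex fps)"
  have "f k has_fps_expansion P"
    unfolding P_def using assms by (rule has_fps_expansion_iterated_integral)
  moreover have "P \<noteq> 0"
  proof
    assume "P = 0"
    hence "fps_polylog2 (int k) = (0 :: complex fps)"
      unfolding P_def by (subst (asm) fps_compose_eq_0_iff) auto
    hence "fps_nth (fps_polylog2 (int k)) 1 = (0 :: complex)" by simp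
    thus False by (simp add: fps_polylog2_def)
  qed
  hence "subdegree (fps_two_sin_half :: complex fps) \<le> subdegree P"
    by (intro subdegree_geI) (auto simp: P_def)
  ultimately have "(\<lambda>x. if x = 0 then fps_nth P 1 else f k x / (2 * sin (x/2)))
                     has_fps_expansion P / fps_two_sin_half"
    using subdegree_fps_two_sin_half[where 'a = complex]
    by (intro has_fps_expansion_divide has_fps_expansion_two_sin_half) auto
  note has_fps_expansion_sums[OF this]
  hence "\<forall>\<^sub>F x in at 0. (\<lambda>n. fps_nth (P / fps_two_sin_half) n * x ^ n) sums
           (if x = 0 then fps_nth P 1 else f k x / (2 * sin (x/2)))"
    by (simp add: eventually_nhds_conv_at)
  moreover have "\<forall>\<^sub>F x in at 0. x \<noteq> (0::complex)"
    by (simp add: eventually_at_filter)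
  ultimately show ?thesis
    by eventually_elim (simp add: poly_bernoulli2_def P_def)
qed

end
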